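(* Let $\phi(a,b,c,d)=(ab+cd)(ac-bd)$. For arbitrary parameters $p,q,r,s$, define \[ \begin{aligned} X_1&=\phi(p,q,r,s), & X_2&=\phi(p,r,s,q), & X_3&=\phi(p,s,q,r),\\ Y_1&=\phi(p,q,s,r), & Y_2&=\phi(p,r,q,s), & Y_3&=\phi(p,s,r,q). \end{aligned} \] Then $X_1^2+X_2^2+X_3^2=Y_1^2+Y_2^2+Y_3^2$ and $X_1X_2X_3=Y_1Y_2Y_3$.
   Context: Parameters $p,q,r,s$ are arbitrary integers (or rationals). *)

theory Defs
  imports Complex_Main
begin

definition phi :: "'a::comm_ring_1 \<Rightarrow> 'a \<Rightarrow> 'a \<Rightarrow> 'a \<Rightarrow> 'a" where
  "phi a b c d = (a * b + c * d) * (a * c - b * d)"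

end

theory Submission
  imports Defs
begin

text \<open>With \<open>u\<^sub>1 = p q + r s\<close>, \<open>v\<^sub>1 = p q - r s\<close> and cyclically in \<open>q, r, s\<close>, the \<open>X\<^sub>i\<close> are
  \<open>u\<^sub>1 v\<^sub>2, u\<^sub>2 v\<^sub>3, u\<^sub>3 v\<^sub>1\<close> and the \<open>Y\<^sub>i\<close> are \<open>u\<^sub>1 v\<^sub>3, u\<^sub>2 v\<^sub>1, u\<^sub>3 v\<^sub>2\<close>, so the products agree.
  The sums of squares agree because \<open>u\<^sub>i\<^sup>2 - v\<^sub>i\<^sup>2 = 4 p q r s\<close> does not depend on \<open>i\<close>.\<close>

theorem theorem2:
  fixes p q r s X1 X2 X3 Y1 Y2 Y3 :: "'a::comm_ring_1"
  assumes "X1 = phi p q r s" and "X2 = phi p r s q" and "X3 = phi p s q r"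
    and "Y1 = phi p q s r" and "Y2 = phi p r q s" and "Y3 = phi p s r q"
  shows "X1^2 + X2^2 + X3^2 = Y1^2 + Y2^2 + Y3^2 \<and> X1 * X2 * X3 = Y1 * Y2 * Y3"
proof
  show "X1^2 + X2^2 + X3^2 = Y1^2 + Y2^2 + Y3^2"
    \<comment> \<open>Replacing each \<open>u\<^sub>i\<^sup>2\<close> by
      \<open>v\<^sub>i\<^sup>2 + 4 p q r s\<close> makes both sides the same symmetric polynomial in
      the \<open>v\<^sub>i\<^sup>2\<close>; here this is checked by full expansion into monomials in
      \<open>p, q, r, s\<close>.\<close>
    unfolding assms phi_def by (simp add: power2_eq_square algebra_simps)
  show "X1 * X2 * X3 = Y1 * Y2 * Y3"
    \<comment> \<open>No expansion here: both sides have the same six factors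
      \<open>u\<^sub>i\<close>, \<open>v\<^sub>i\<close>, up to reordering inside and between
      them.\<close>
    unfolding assms phi_def by (simp add: ac_simps)
qed

end
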